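(* Let $G$ be a finite simple connected graph of order $n\geq 3$. Then $\psi(G)=n-1$ if and only if $G$ is (isomorphic to) one of $K_n$, $K_{1,n-1}$, $K_{2,n-2}$, or $K_2\vee\overline{K_{n-2}}$.
   Context: $d(u,v)$ denotes the length of a shortest path between $u$ and $v$ in $G$. Two vertices $u,v$ of a connected graph $G$ are doubly resolved by vertices $x,y$ of $G$ if $d(v,x)-d(u,x)\neq d(v,y)-d(u,y)$. A set $W\subseteq V(G)$ is a doubly resolving set for $G$ if every two distinct vertices of $G$ are doubly resolved by some two vertices of $W$. The doubly resolving number $\psi(G)$ is the minimum cardinality of a doubly resolving set for $G$. $K_n$ is the complete graph on $n$ vertices, $K_{r,s}$ is the complete bipartite graph with partite sets of sizes $r$ and $s$, and $\overline{K_n}$ is the complement of $K_n$ (the edgeless graph on $n$ vertices). For graphs $G,H$ with disjoint vertex sets, the join $G\vee H$ is the graph with vertex set $V(G)\cup V(H)$ and edge set $E(G)\cup E(H)\cup\{uv : u\in V(G), v\in V(H)\}$. *)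

theory Defs
  imports "Graph_Theory.Graph_Theory"
begin

text \<open>
  A finite simple graph is a \<^locale>\<open>pair_graph\<close>: an undirected edge is represented by the two
  arcs \<open>(u,v)\<close> and \<open>(v,u)\<close>.
\<close>

text \<open>Only meaningful if some path joins \<open>u\<close> and \<open>v\<close>, in particular if \<open>G\<close> is connected.\<close>

definition graph_dist :: "('a,'b) pre_digraph \<Rightarrow> 'a \<Rightarrow> 'a \<Rightarrow> nat" where
  "graph_dist G u v = (LEAST k. \<exists>p. pre_digraph.apath G u p v \<and> length p = k)"

definition doubly_resolved :: "('a,'b) pre_digraph \<Rightarrow> 'a \<Rightarrow> 'a \<Rightarrow> 'a \<Rightarrow> 'a \<Rightarrow> bool" where
  "doubly_resolved G u v x y \<longleftrightarrow>
     int (graph_dist G v x) - int (graph_dist G u x) \<noteq> int (graph_dist G v y) - int (graph_dist G u y)"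

definition doubly_resolving_set :: "('a,'b) pre_digraph \<Rightarrow> 'a set \<Rightarrow> bool" where
  "doubly_resolving_set G W \<longleftrightarrow> W \<subseteq> verts G \<and>
     (\<forall>u\<in>verts G. \<forall>v\<in>verts G. u \<noteq> v \<longrightarrow> (\<exists>x\<in>W. \<exists>y\<in>W. doubly_resolved G u v x y))"

definition doubly_resolving_number :: "('a,'b) pre_digraph \<Rightarrow> nat" where
  "doubly_resolving_number G = (LEAST k. \<exists>W. doubly_resolving_set G W \<and> card W = k)"

definition complete_graph :: "nat \<Rightarrow> nat pair_pre_digraph" where
  "complete_graph n = \<lparr>pverts = {..<n}, parcs = {(u, v). u < n \<and> v < n \<and> u \<noteq> v}\<rparr>"

definition graph_complement :: "'a pair_pre_digraph \<Rightarrow> 'a pair_pre_digraph" where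
  "graph_complement G =
     \<lparr>pverts = pverts G, parcs = {(u, v) \<in> pverts G \<times> pverts G. u \<noteq> v \<and> (u, v) \<notin> parcs G}\<rparr>"

text \<open>The vertex sets are made disjoint by taking their disjoint sum.\<close>

definition graph_join :: "'a pair_pre_digraph \<Rightarrow> 'b pair_pre_digraph \<Rightarrow> ('a + 'b) pair_pre_digraph"
  (infixl \<open>\<or>\<^sub>G\<close> 65) where
  "G \<or>\<^sub>G H = \<lparr>pverts = pverts G <+> pverts H,
     parcs = map_prod Inl Inl ` parcs G \<union> map_prod Inr Inr ` parcs H
           \<union> Inl ` pverts G \<times> Inr ` pverts H \<union> Inr ` pverts H \<times> Inl ` pverts G\<rparr>"

text \<open>
  The library's \<open>K\<^bsub>n\<^esub> G\<close> and \<open>K\<^bsub>r,s\<^esub> G\<close> are predicates stating that \<open>G\<close> is a complete graph on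
  \<open>n\<close> vertices, respectively a complete bipartite graph with parts of sizes \<open>r\<close> and \<open>s\<close>. They thus
  describe an isomorphism class, of which \<^const>\<open>complete_graph\<close> is a concrete member.
\<close>

lemma complete_digraph_complete_graph: "K\<^bsub>n\<^esub> (with_proj (complete_graph n))"
  by (auto simp: complete_digraph_pair_def complete_graph_def)

lemma parcs_complement_complete_graph: "parcs (graph_complement (complete_graph n)) = {}"
  by (auto simp: graph_complement_def complete_graph_def)

end

theory Submission
  imports Defs
begin

text \<open>
  A set \<open>W\<close> fails to doubly resolve \<open>u\<close> and \<open>v\<close> iff \<open>d(v,x) - d(u,x)\<close> is constant for \<open>x \<in> W\<close>. If both
  lie in \<open>W\<close>, then \<open>x = u\<close> and \<open>x = v\<close> give values of opposite sign. If only \<open>v\<close> lies in \<open>W\<close>, then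
  \<open>x = v\<close> fixes the constant, and failure says that every vertex of \<open>W\<close> is reached from \<open>u\<close> by a
  shortest path through \<open>v\<close>. So leaving out one vertex \<open>z\<close> is harmless unless all neighbours of \<open>z\<close>
  coincide. As some vertex of a connected graph with at least three vertices has two neighbours,
  \<open>\<psi>(G) \<le> n - 1\<close>. Hence \<open>\<psi>(G) = n - 1\<close> iff leaving out any two vertices \<open>p\<close>, \<open>q\<close> destroys double
  resolution (lemma \<open>doubly_resolving_number_eq_iff\<close>).

  Suppose this happens for all pairs. Two consecutive inner vertices of a shortest path of length
  at least 3 could be left out, so the diameter is at most 2 (lemma \<open>dist_le_2\<close>). Then, for \<open>p\<close> and
  \<open>q\<close> that each have a neighbour outside \<open>{p, q}\<close>, only two obstructions remain (lemma
  \<open>twins_or_gateway\<close>): \<open>p\<close> and \<open>q\<close> have the same neighbours outside \<open>{p, q}\<close>, or one of them, say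
  \<open>p\<close>, sees the rest of the graph only through a single vertex \<open>v\<close>, which in turn is adjacent to
  all vertices except possibly \<open>q\<close>. If \<open>G\<close> has a leaf, this makes \<open>G\<close> a star. If \<open>G\<close> has no leaf and
  all pairs are twins, \<open>G\<close> is complete. Otherwise, some pair yields \<open>p\<close> with neighbourhood \<open>{v, q}\<close>,
  and comparing \<open>q\<close> with any other vertex \<open>r\<close> shows that \<open>r\<close> has neighbourhood \<open>{v, q}\<close> too.

  So a graph that is not complete is the join of an independent set with one or two further
  vertices \<open>A\<close>. One vertex gives \<open>K\<^bsub>1,n-1\<^esub>\<close>; two give \<open>K\<^bsub>2,n-2\<^esub>\<close> or the join of \<open>K\<^sub>2\<close> with an
  independent set, depending on whether they are adjacent. Conversely, omitted
  twins cannot be told apart, and any two vertices of a complete graph are twins. So are, in a join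
  as above, two vertices in \<open>A\<close> and two vertices outside. If \<open>r\<close> outside and \<open>a\<close> in \<open>A\<close> are omitted,
  then \<open>r\<close> cannot be told apart from the other vertex of \<open>A\<close> (or from \<open>a\<close> itself, if \<open>A = {a}\<close>),
  which is closer to every remaining vertex by exactly 1.
\<close>

section \<open>Distances in connected graphs\<close>

locale connected_pair_graph = pair_graph G for G :: "'a pair_pre_digraph" +
  assumes conn: "Digraph_Component.connected (with_proj G)"
begin

abbreviation V :: "'a set" where "V \<equiv> pverts G"

abbreviation adj :: "'a \<Rightarrow> 'a \<Rightarrow> bool" (infix \<open>\<sim>\<close> 50) where
  "u \<sim> v \<equiv> (u, v) \<in> parcs G"

abbreviation d :: "'a \<Rightarrow> 'a \<Rightarrow> nat" where
  "d \<equiv> graph_dist (with_proj G)"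

lemma adj_sym: "u \<sim> v \<Longrightarrow> v \<sim> u"
  using arcs_symmetric by blast

lemma ex_shortest_apath:
  assumes "u \<in> V" "v \<in> V"
  shows "\<exists>p. apath u p v \<and> length p = d u v"
proof -
  have "strongly_connected (with_proj G)"
    using symmetric_connected_imp_strongly_connected[OF pair_sym_arcs conn] .
  then have "u \<rightarrow>\<^sup>*\<^bsub>with_proj G\<^esub> v"
    using assms by (auto simp: strongly_connected_def)
  then have "\<exists>k p. apath u p v \<and> length p = k"
    using reachable_apath by blast
  then show ?thesis
    unfolding graph_dist_def by (rule LeastI_ex)
qed

lemma dist_le_length: "apath u p v \<Longrightarrow> d u v \<le> length p"
  unfolding graph_dist_def by (rule Least_le) blast

lemma dist_self [simp]: "u \<in> V \<Longrightarrow> d u u = 0"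
  using dist_le_length[of u "[]" u] by (simp add: apath_Nil_iff)

lemma dist_pos:
  assumes "u \<in> V" "v \<in> V" "u \<noteq> v"
  shows "0 < d u v"
proof -
  obtain p where "apath u p v" "length p = d u v"
    using ex_shortest_apath[OF assms(1,2)] by blast
  with assms(3) show ?thesis by (cases p) (auto simp: apath_Nil_iff)
qed

lemma dist_le_Suc:
  assumes "u \<sim> v" "w \<in> V"
  shows "d u w \<le> Suc (d v w)"
proof -
  have V: "u \<in> V" "v \<in> V" using assms(1) wellformed' by auto
  obtain p where p: "apath v p w" "length p = d v w"
    using ex_shortest_apath V assms(2) by blast
  show ?thesis
  proof (cases "u \<in> set (pawalk_verts v p)")
    case True
    \<comment> \<open>Then the rest of the path from \<open>u\<close> onwards is already a path from \<open>u\<close> to \<open>w\<close>.\<close>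
    then obtain q r where qr: "p = q @ r" "awalk v q u"
      using awalk_decomp[of v p w u] p(1) by (auto simp: apath_def)
    then have "apath u r w"
      using p(1) apath_append_iff[of v q r w] by auto
    then show ?thesis using dist_le_length[of u r w] p(2) qr(1) by simp
  next
    case False
    then have "apath u ((u, v) # p) w"
      using p(1) assms(1) by (simp add: apath_Cons_iff)
    then show ?thesis using dist_le_length p(2) by fastforce
  qed
qed

lemma dist_Suc_step:
  assumes "u \<in> V" "w \<in> V" "u \<noteq> w"
  obtains v where "u \<sim> v" "d u w = Suc (d v w)"
proof -
  obtain p where p: "apath u p w" "length p = d u w"
    using ex_shortest_apath assms by blast
  then obtain e es where es: "p = e # es"
    using assms by (cases p) (auto simp: apath_Nil_iff)
  have step: "u \<sim> snd e" "apath (snd e) es w"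
    using p(1) es by (auto simp: apath_Cons_iff)
  have "d (snd e) w \<le> length es"
    using step(2) by (rule dist_le_length)
  moreover have "d u w \<le> Suc (d (snd e) w)"
    by (rule dist_le_Suc) (use step in_arcsD2 assms in auto)
  ultimately have "d u w = Suc (d (snd e) w)"
    using p(2) es by simp
  then show thesis using step(1) that by blast
qed

lemma dist_adj: "u \<sim> v \<Longrightarrow> d u v = 1"
  using dist_le_Suc[of u v v] dist_pos[of u v] wellformed'[of u v] no_loops'[of u v] by force

lemma adj_if_dist_le_1:
  assumes "u \<in> V" "v \<in> V" "u \<noteq> v" "d u v \<le> 1"
  shows "u \<sim> v"
  using dist_Suc_step[OF assms(1-3)] assms(2,4) dist_pos wellformed'
  by (metis One_nat_def Suc_le_mono le_zero_eq less_irrefl)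

lemma adj_iff_dist:
  assumes "u \<in> V" "v \<in> V" "u \<noteq> v"
  shows "u \<sim> v \<longleftrightarrow> d u v = 1"
  using dist_adj[of u v] adj_if_dist_le_1[OF assms] by auto

lemma dist_ge_2:
  assumes "u \<in> V" "v \<in> V" "u \<noteq> v" "\<not> u \<sim> v"
  shows "2 \<le> d u v"
  using adj_if_dist_le_1 assms by force

lemma dist_2_via:
  assumes "u \<sim> a" "a \<sim> v" "u \<noteq> v" "\<not> u \<sim> v"
  shows "d u v = 2"
proof -
  have "u \<in> V" "v \<in> V" using assms wellformed' by auto
  then show ?thesis
    using dist_le_Suc[OF assms(1), of v] dist_adj[OF assms(2)] dist_ge_2[of u v] assms by simp
qed

section \<open>Vertices that a set fails to resolve\<close>

definition resolves :: "'a set \<Rightarrow> 'a \<Rightarrow> 'a \<Rightarrow> bool" where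
  "resolves W u v \<longleftrightarrow> (\<exists>x\<in>W. \<exists>y\<in>W. doubly_resolved (with_proj G) u v x y)"

abbreviation doubly_resolving :: "'a set \<Rightarrow> bool" where
  "doubly_resolving W \<equiv> doubly_resolving_set (with_proj G) W"

lemma doubly_resolving_iff:
  "doubly_resolving W \<longleftrightarrow> W \<subseteq> V \<and> (\<forall>u\<in>V. \<forall>v\<in>V. u \<noteq> v \<longrightarrow> resolves W u v)"
  by (simp add: doubly_resolving_set_def resolves_def)

lemma resolves_sym: "resolves W u v \<Longrightarrow> resolves W v u"
  unfolding resolves_def doubly_resolved_def by (metis minus_diff_eq)

lemma resolves_mono: "resolves W u v \<Longrightarrow> W \<subseteq> W' \<Longrightarrow> resolves W' u v"
  unfolding resolves_def by blast

lemma doubly_resolving_mono: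
  "doubly_resolving W \<Longrightarrow> W \<subseteq> W' \<Longrightarrow> W' \<subseteq> V \<Longrightarrow> doubly_resolving W'"
  unfolding doubly_resolving_iff using resolves_mono by blast

lemma resolves_members:
  assumes "u \<in> W" "v \<in> W" "W \<subseteq> V" "u \<noteq> v"
  shows "resolves W u v"
proof -
  have "doubly_resolved (with_proj G) u v u v"
    using assms dist_pos[of u v] dist_pos[of v u]
    by (auto simp: doubly_resolved_def subset_iff)
  then show ?thesis using assms unfolding resolves_def by blast
qed

text \<open>
  Taking \<open>x = v\<close> determines the constant difference as \<open>- d u v\<close>. The right-hand side thus says that
  \<open>v\<close> lies on a shortest path from \<open>u\<close> to every vertex of \<open>W\<close>.
\<close>

lemma not_resolves_member_iff:
  assumes "v \<in> W" "W \<subseteq> V"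
  shows "\<not> resolves W u v \<longleftrightarrow> (\<forall>x\<in>W. d u x = d v x + d u v)"
proof
  assume unres: "\<not> resolves W u v"
  show "\<forall>x\<in>W. d u x = d v x + d u v"
  proof
    fix x assume "x \<in> W"
    then have "int (d v x) - int (d u x) = int (d v v) - int (d u v)"
      using unres assms unfolding resolves_def doubly_resolved_def by blast
    moreover have "d v v = 0" using assms by auto
    ultimately show "d u x = d v x + d u v" by linarith
  qed
next
  assume "\<forall>x\<in>W. d u x = d v x + d u v"
  then show "\<not> resolves W u v"
    unfolding resolves_def doubly_resolved_def by simp
qed

text \<open>
  At least one of the unresolved vertices is omitted. Either both are, or the omitted one reaches all
  of the set through the other one.
\<close>

lemma unresolved_two_omitted:
  assumes "p \<in> V" "q \<in> V" "p \<noteq> q" "\<not> doubly_resolving (V - {p, q})"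
  shows "\<not> resolves (V - {p, q}) p q
    \<or> (\<exists>v\<in>V - {p, q}. \<forall>x\<in>V - {p, q}. d p x = d v x + d p v)
    \<or> (\<exists>v\<in>V - {p, q}. \<forall>x\<in>V - {p, q}. d q x = d v x + d q v)"
proof -
  obtain u v where uv: "u \<in> V" "v \<in> V" "u \<noteq> v" "\<not> resolves (V - {p, q}) u v"
    using assms(4) unfolding doubly_resolving_iff by blast
  have "u \<in> {p, q} \<or> v \<in> {p, q}"
    using resolves_members[of u "V - {p, q}" v] uv by blast
  then consider "u \<in> {p, q}" "v \<in> V - {p, q}" | "v \<in> {p, q}" "u \<in> V - {p, q}"
    | "u = p \<and> v = q \<or> u = q \<and> v = p"
    using uv(1-3) by auto
  then show ?thesis
  proof cases
    case 1
    then have "\<forall>x\<in>V - {p, q}. d u x = d v x + d u v"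
      using not_resolves_member_iff[of v "V - {p, q}" u] uv(4) by blast
    then show ?thesis using 1 by blast
  next
    case 2
    have "\<not> resolves (V - {p, q}) v u" using uv(4) resolves_sym by metis
    then have "\<forall>x\<in>V - {p, q}. d v x = d u x + d v u"
      using not_resolves_member_iff[of u "V - {p, q}" v] 2(2) by blast
    then show ?thesis using 2 by blast
  next
    case 3
    then have "\<not> resolves (V - {p, q}) p q" using uv(4) resolves_sym by metis
    then show ?thesis ..
  qed
qed

section \<open>Reduction to sets omitting two vertices\<close>

definition no_pair_omittable :: bool where
  "no_pair_omittable \<longleftrightarrow> (\<forall>p\<in>V. \<forall>q\<in>V. p \<noteq> q \<longrightarrow> \<not> doubly_resolving (V - {p, q}))"

text \<open>
  The only pairs at risk are \<open>z\<close> and some \<open>v\<close>. Were they unresolved, every neighbour of \<open>z\<close> other than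
  \<open>v\<close> would be reached through \<open>v\<close> and hence have distance at least 2 from \<open>z\<close>.
\<close>

lemma doubly_resolving_omit_nonleaf:
  assumes "z \<sim> a" "z \<sim> b" "a \<noteq> b"
  shows "doubly_resolving (V - {z})"
  unfolding doubly_resolving_iff
proof (intro conjI ballI impI)
  have z: "resolves (V - {z}) z v" if v: "v \<in> V - {z}" for v
  proof (rule ccontr)
    assume "\<not> resolves (V - {z}) z v"
    then have eq: "\<forall>x\<in>V - {z}. d z x = d v x + d z v"
      using not_resolves_member_iff[of v "V - {z}" z] v by blast
    have "c = v" if "z \<sim> c" for c
    proof (rule ccontr)
      assume "c \<noteq> v"
      moreover have "c \<in> V - {z}" using wellformed'[OF that] no_loops'[OF that] by blast
      ultimately have "d z c = d v c + d z v" "0 < d v c" "0 < d z v"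
        using bspec[OF eq, of c] v dist_pos[of v c] dist_pos[of z v] wellformed'[OF that] by auto
      then show False using dist_adj[OF that] by simp
    qed
    then show False using assms by blast
  qed
  fix u v assume "u \<in> V" "v \<in> V" "u \<noteq> v"
  then show "resolves (V - {z}) u v"
    using z[of v] resolves_sym[OF z[of u]] resolves_members[of u "V - {z}" v] by blast
qed simp

lemma ex_nonleaf:
  assumes "3 \<le> card V"
  shows "\<exists>z a b. z \<sim> a \<and> z \<sim> b \<and> a \<noteq> b"
proof (cases "\<forall>u\<in>V. \<forall>w\<in>V. u \<noteq> w \<longrightarrow> u \<sim> w")
  case True
  from assms obtain T where "T \<subseteq> V" "card T = 3"
    using obtain_subset_with_card_n by metis
  then obtain x y z where "x \<in> V" "y \<in> V" "z \<in> V" "x \<noteq> y" "y \<noteq> z" "x \<noteq> z"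
    by (auto simp: card_3_iff)
  then show ?thesis using True by blast
next
  case False
  then obtain u w where uw: "u \<in> V" "w \<in> V" "u \<noteq> w" "\<not> u \<sim> w" by blast
  then obtain v where v: "u \<sim> v" "d u w = Suc (d v w)" using dist_Suc_step by blast
  then have "v \<in> V" "v \<noteq> w" using uw wellformed' by auto
  then obtain t where t: "v \<sim> t" "d v w = Suc (d t w)" using dist_Suc_step uw by blast
  then have "t \<noteq> u" using v by auto
  then show ?thesis using v t adj_sym by blast
qed

lemma doubly_resolving_number_eq_iff:
  assumes "3 \<le> card V"
  shows "doubly_resolving_number (with_proj G) = card V - 1 \<longleftrightarrow> no_pair_omittable"
    (is "?psi = _ \<longleftrightarrow> _")
proof -
  have upper: "?psi \<le> card W" if "doubly_resolving W" for W
    unfolding doubly_resolving_number_def by (rule Least_le) (use that in blast)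
  obtain z where z: "z \<in> V" "doubly_resolving (V - {z})"
    using ex_nonleaf[OF assms] doubly_resolving_omit_nonleaf wellformed' by metis
  then have "\<exists>k W. doubly_resolving W \<and> card W = k" by blast
  then have "\<exists>W. doubly_resolving W \<and> card W = ?psi"
    unfolding doubly_resolving_number_def by (rule LeastI_ex)
  then obtain W where W: "doubly_resolving W" "card W = ?psi" by blast
  have le: "?psi \<le> card V - 1"
    using upper[OF z(2)] z(1) by simp
  show ?thesis
  proof
    assume eq: "?psi = card V - 1"
    show no_pair_omittable
      unfolding no_pair_omittable_def
    proof (intro ballI impI notI)
      fix p q assume pq: "p \<in> V" "q \<in> V" "p \<noteq> q" "doubly_resolving (V - {p, q})"
      have "card (V - {p, q}) = card V - 2"
        using pq by (subst card_Diff_subset) auto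
      then show False using upper[OF pq(4)] eq assms by simp
    qed
  next
    assume omit: no_pair_omittable
    show "?psi = card V - 1"
    proof (rule ccontr)
      assume "?psi \<noteq> card V - 1"
      then have "card W + 2 \<le> card V" using le W(2) assms by simp
      moreover have "W \<subseteq> V" using W(1) unfolding doubly_resolving_iff by blast
      ultimately have "2 \<le> card (V - W)"
        by (simp add: card_Diff_subset finite_subset)
      then obtain T where "T \<subseteq> V - W" "card T = 2"
        using obtain_subset_with_card_n by metis
      then obtain p q where pq: "p \<in> V - W" "q \<in> V - W" "p \<noteq> q"
        by (auto simp: card_2_iff)
      then have "doubly_resolving (V - {p, q})"
        by (intro doubly_resolving_mono[OF W(1)]) (use \<open>W \<subseteq> V\<close> in auto)
      then show False using omit pq unfolding no_pair_omittable_def by blast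
    qed
  qed
qed

section \<open>The four families omit no pair\<close>

definition twins :: "'a \<Rightarrow> 'a \<Rightarrow> bool" where
  "twins p q \<longleftrightarrow> (\<forall>x\<in>V - {p, q}. p \<sim> x \<longleftrightarrow> q \<sim> x)"

lemma twins_sym: "twins p q \<Longrightarrow> twins q p"
  unfolding twins_def by auto

text \<open>
  The first step of a shortest path from \<open>p\<close> leads to \<open>q\<close> or to a common neighbour, so \<open>q\<close> can take
  the same route.
\<close>

lemma twins_dist_le:
  assumes "twins p q" "p \<in> V" "q \<in> V" "x \<in> V - {p, q}"
  shows "d q x \<le> d p x"
proof -
  obtain v where v: "p \<sim> v" "d p x = Suc (d v x)"
    using dist_Suc_step assms by blast
  show ?thesis
  proof (cases "v = q")
    case False
    then have "q \<sim> v" using assms(1) v(1) wellformed'[OF v(1)] no_loops'[OF v(1)]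
      unfolding twins_def by blast
    then show ?thesis using dist_le_Suc v(2) assms(4) by simp
  qed (use v in simp)
qed

lemma not_doubly_resolving_omit_twins:
  assumes "p \<in> V" "q \<in> V" "p \<noteq> q" "twins p q"
  shows "\<not> doubly_resolving (V - {p, q})"
proof -
  have "d p x = d q x" if "x \<in> V - {p, q}" for x
    using twins_dist_le[of p q x] twins_dist_le[of q p x] twins_sym assms that
    by (simp add: antisym)
  then have "\<not> resolves (V - {p, q}) p q"
    unfolding resolves_def doubly_resolved_def by simp
  then show ?thesis unfolding doubly_resolving_iff using assms by blast
qed

definition complete :: bool where
  "complete \<longleftrightarrow> (\<forall>u\<in>V. \<forall>v\<in>V. u \<noteq> v \<longrightarrow> u \<sim> v)"

text \<open>
  A set \<open>A\<close> with this property exhibits the graph as the join of its subgraph induced on \<open>A\<close> with an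
  independent set.
\<close>

definition core :: "'a set \<Rightarrow> bool" where
  "core A \<longleftrightarrow> A \<subseteq> V \<and> (\<forall>r\<in>V - A. \<forall>v. r \<sim> v \<longleftrightarrow> v \<in> A)"

lemma no_pair_omittable_complete: "complete \<Longrightarrow> no_pair_omittable"
  unfolding no_pair_omittable_def complete_def
  by (intro ballI impI not_doubly_resolving_omit_twins) (auto simp: twins_def)

text \<open>
  With \<open>a\<close> omitted, every vertex of the set other than \<open>v\<close> is outside \<open>A\<close> and so has distance 2 from
  \<open>r\<close> and distance 1 from \<open>v\<close>. At \<open>v\<close> itself the distances are 1 and 0. The case \<open>v = a\<close> serves for
  singletons \<open>A\<close>.
\<close>

lemma core_not_doubly_resolving_omit_mixed:
  assumes core: "core A" and A: "v \<in> A" "A \<subseteq> {a, v}" and r: "r \<in> V - A"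
  shows "\<not> doubly_resolving (V - {r, a})"
proof -
  have adj: "s \<sim> t \<longleftrightarrow> t \<in> A" if "s \<in> V - A" for s t
    using core that unfolding core_def by blast
  have "v \<in> V" using core A unfolding core_def by blast
  have "d r x = d v x + 1" if x: "x \<in> V - {r, a}" for x
  proof (cases "x = v")
    case True
    then show ?thesis using adj[of r v] A r dist_adj \<open>v \<in> V\<close> by simp
  next
    case False
    then have "x \<in> V - A" using x A by blast
    then have "r \<sim> v" "v \<sim> x" "\<not> r \<sim> x"
      using adj[of r] adj[of x v] A r adj_sym by auto
    then show ?thesis using dist_2_via[of r v x] dist_adj[of v x] x by auto
  qed
  then have "\<not> resolves (V - {r, a}) r v"
    unfolding resolves_def doubly_resolved_def by simp
  moreover have "r \<in> V" "r \<noteq> v" using r A(1) by auto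
  ultimately show ?thesis
    unfolding doubly_resolving_iff using \<open>v \<in> V\<close> by blast
qed

lemma no_pair_omittable_core:
  assumes core: "core A" and card: "card A = 1 \<or> card A = 2"
  shows no_pair_omittable
  unfolding no_pair_omittable_def
proof (intro ballI impI)
  fix p q assume pq: "p \<in> V" "q \<in> V" "p \<noteq> q"
  have adj: "s \<sim> t \<longleftrightarrow> t \<in> A" if "s \<in> V - A" for s t
    using core that unfolding core_def by blast
  have mixed: "\<not> doubly_resolving (V - {r, a})" if "a \<in> A" "r \<in> V - A" for a r
  proof -
    have "\<exists>v\<in>A. A \<subseteq> {a, v}"
      using card \<open>a \<in> A\<close> by (auto simp: card_1_singleton_iff card_2_iff)
    then show ?thesis using core_not_doubly_resolving_omit_mixed[OF core] that by blast
  qed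
  consider "p \<in> A" "q \<in> A" | "p \<in> V - A" "q \<in> V - A" | "p \<in> A" "q \<in> V - A"
    | "q \<in> A" "p \<in> V - A"
    using pq by blast
  then show "\<not> doubly_resolving (V - {p, q})"
  proof cases
    case 1
    then have "A = {p, q}"
      using card pq(3) by (auto simp: card_1_singleton_iff card_2_iff)
    then have "twins p q" unfolding twins_def using adj adj_sym 1 by blast
    then show ?thesis using not_doubly_resolving_omit_twins pq by blast
  next
    case 2
    then have "twins p q" unfolding twins_def using adj by blast
    then show ?thesis using not_doubly_resolving_omit_twins pq by blast
  next
    case 3
    then show ?thesis using mixed by (metis insert_commute)
  next
    case 4
    then show ?thesis using mixed by blast
  qed
qed

section \<open>Graphs in which no pair can be omitted\<close>

text \<open>
  Otherwise take a shortest path \<open>u, p, q, t, \<dots>, w\<close>; the vertices \<open>t\<close> and \<open>w\<close> may coincide. Each of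
  the three ways in which the complement of \<open>{p, q}\<close> could fail to be doubly resolving contradicts the
  distances to \<open>u\<close>, \<open>t\<close> and \<open>w\<close>.
\<close>

lemma dist_le_2:
  assumes omit: no_pair_omittable and V: "u \<in> V" "w \<in> V"
  shows "d u w \<le> 2"
proof (rule ccontr)
  assume far: "\<not> d u w \<le> 2"
  then have "u \<noteq> w" using V by auto
  then obtain p where p: "u \<sim> p" "d u w = Suc (d p w)"
    using dist_Suc_step V by blast
  then have pw: "p \<in> V" "p \<noteq> w" using far V wellformed' by auto
  then obtain q where q: "p \<sim> q" "d p w = Suc (d q w)"
    using dist_Suc_step V by blast
  then have qw: "q \<in> V" "q \<noteq> w" using far p V wellformed' by auto
  then obtain t where t: "q \<sim> t" "d q w = Suc (d t w)"
    using dist_Suc_step V by blast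
  have tV: "t \<in> V" using t wellformed' by blast
  have ne: "u \<noteq> p" "u \<noteq> q" "p \<noteq> q" "t \<noteq> p" "t \<noteq> q" "t \<noteq> u" using p q t by auto
  have "\<not> u \<sim> q" using dist_le_Suc[of u q w] V p q by auto
  have dpu: "d p u = 1" using dist_adj[OF adj_sym[OF p(1)]] .
  have dqu: "d q u = 2"
    using dist_2_via[OF adj_sym[OF q(1)] adj_sym[OF p(1)]] ne \<open>\<not> u \<sim> q\<close> adj_sym by metis
  have dqt: "d q t = 1" using dist_adj[OF t(1)] .
  let ?W = "V - {p, q}"
  have W: "u \<in> ?W" "w \<in> ?W" "t \<in> ?W" using V pw qw tV ne by auto
  have "\<not> doubly_resolving ?W"
    using omit pw(1) qw(1) ne(3) unfolding no_pair_omittable_def by blast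
  then consider "\<not> resolves ?W p q"
    | v where "v \<in> ?W" "\<forall>x\<in>?W. d p x = d v x + d p v"
    | v where "v \<in> ?W" "\<forall>x\<in>?W. d q x = d v x + d q v"
    using unresolved_two_omitted pw(1) qw(1) ne(3) by blast
  then show False
  proof cases
    \<comment> \<open>The vertex \<open>p\<close> is closer to \<open>u\<close>, and \<open>q\<close> is closer to \<open>w\<close>.\<close>
    case 1
    then have "int (d q u) - int (d p u) = int (d q w) - int (d p w)"
      using W unfolding resolves_def doubly_resolved_def by blast
    then show False using dpu dqu q(2) by simp
  next
    \<comment> \<open>As a neighbour of \<open>p\<close>, \<open>u\<close> must be \<open>v\<close>; but it does not lie on the way from \<open>p\<close> to \<open>w\<close>.\<close>
    case 2
    then have "d p u = d v u + d p v" "d p w = d v w + d p v" using W by blast+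
    moreover have "0 < d p v" using 2(1) dist_pos pw(1) by auto
    ultimately have "d v u = 0" using dpu by linarith
    then have "v = u" using dist_pos[of v u] V 2(1) by auto
    then show False
      using \<open>d p w = d v w + d p v\<close>[unfolded \<open>v = u\<close>] p(2) by linarith
  next
    \<comment> \<open>Likewise \<open>t = v\<close>, which puts \<open>t\<close> on the way from \<open>q\<close> to \<open>u\<close>, next to \<open>u\<close>: a shortcut to \<open>w\<close>.\<close>
    case 3
    then have eq: "d q t = d v t + d q v" "d q u = d v u + d q v" using W by blast+
    moreover have "0 < d q v" using 3(1) dist_pos qw(1) by auto
    ultimately have "d v t = 0" "d q v = 1" using dqt by linarith+
    then have "v = t" using dist_pos[of v t] tV 3(1) by auto
    then have "d t u = 1" using eq(2) dqu \<open>d q v = 1\<close> by simp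
    then have "u \<sim> t" using adj_if_dist_le_1[of t u] tV V ne adj_sym by auto
    then show False using dist_le_Suc[of u t w] V p q t by simp
  qed
qed

text \<open>
  In a graph of diameter at most 2, this is what remains of the statement that \<open>v\<close> lies on a shortest
  path from \<open>p\<close> to every vertex except possibly \<open>q\<close>.
\<close>

definition gateway :: "'a \<Rightarrow> 'a \<Rightarrow> 'a \<Rightarrow> bool" where
  "gateway p q v \<longleftrightarrow> v \<in> V - {p, q} \<and> (\<forall>x. p \<sim> x \<longrightarrow> x = v \<or> x = q) \<and> (\<forall>x\<in>V - {v, q}. v \<sim> x)"

text \<open>
  A neighbour of \<open>p\<close> other than \<open>q\<close> leaves no room for a step beyond \<open>v\<close>, so it is \<open>v\<close>. Thus \<open>v\<close> is one
  step from \<open>p\<close>, and by the diameter bound at most one step remains to any other vertex.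
\<close>

lemma gateway_if_unresolved:
  assumes diam: "\<And>x. x \<in> V \<Longrightarrow> d p x \<le> 2" and V: "p \<in> V" "q \<in> V" "p \<noteq> q"
    and a: "p \<sim> a" "a \<noteq> q"
    and v: "v \<in> V - {p, q}" "\<forall>x\<in>V - {p, q}. d p x = d v x + d p v"
  shows "gateway p q v"
proof -
  have pos: "0 < d p v" using v(1) dist_pos V by auto
  have nb: "x = v" if "p \<sim> x" "x \<noteq> q" for x
  proof -
    have x: "x \<in> V - {p, q}" using that wellformed'[OF that(1)] no_loops'[OF that(1)] by blast
    then have "d v x = 0" using bspec[OF v(2) x] dist_adj[OF that(1)] pos by simp
    then show ?thesis using dist_pos[of v x] x v(1) by auto
  qed
  then have "p \<sim> v" using a by blast
  have "v \<sim> x" if "x \<in> V - {v, q}" for x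
  proof (cases "x = p")
    case True
    then show ?thesis using adj_sym \<open>p \<sim> v\<close> by blast
  next
    case False
    then have "d p x = d v x + 1"
      using bspec[OF v(2), of x] that dist_adj[OF \<open>p \<sim> v\<close>] by simp
    then have "d v x \<le> 1" using diam[of x] that by auto
    then show ?thesis using adj_if_dist_le_1[of v x] v(1) that by auto
  qed
  then show ?thesis unfolding gateway_def using v(1) nb by blast
qed

text \<open>
  If \<open>p\<close> and \<open>q\<close> themselves are unresolved, their distances to all other vertices differ by a constant.
  Each of them has a neighbour, to which the other one is not closer; so the constant is 0, and they are
  twins.
\<close>

lemma twins_or_gateway:
  assumes omit: no_pair_omittable and V: "p \<in> V" "q \<in> V" "p \<noteq> q"
    and a: "p \<sim> a" "a \<noteq> q" and b: "q \<sim> b" "b \<noteq> p"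
  shows "twins p q \<or> (\<exists>v. gateway p q v) \<or> (\<exists>v. gateway q p v)"
proof -
  let ?W = "V - {p, q}"
  have W: "a \<in> ?W" "b \<in> ?W"
    using a b wellformed'[OF a(1)] wellformed'[OF b(1)] no_loops'[OF a(1)] no_loops'[OF b(1)] by blast+
  have "\<not> doubly_resolving ?W"
    using omit V unfolding no_pair_omittable_def by blast
  then consider (pq) "\<not> resolves ?W p q"
    | (p) v where "v \<in> ?W" "\<forall>x\<in>?W. d p x = d v x + d p v"
    | (q) v where "v \<in> ?W" "\<forall>x\<in>?W. d q x = d v x + d q v"
    using unresolved_two_omitted V by blast
  then show ?thesis
  proof cases
    case pq
    have "int (d q a) - int (d p a) = int (d q b) - int (d p b)"
      using pq W unfolding resolves_def doubly_resolved_def by blast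
    moreover have "d p a = 1" "d q b = 1" "0 < d q a" "0 < d p b"
      using dist_adj a b dist_pos V W by auto
    ultimately have "d q a = d p a" by linarith
    have "d q x = d p x" if "x \<in> ?W" for x
    proof -
      have "int (d q x) - int (d p x) = int (d q a) - int (d p a)"
        using pq W that unfolding resolves_def doubly_resolved_def by blast
      then show ?thesis using \<open>d q a = d p a\<close> by simp
    qed
    then have "twins p q" unfolding twins_def using V by (auto simp: adj_iff_dist)
    then show ?thesis ..
  next
    case p
    then show ?thesis using gateway_if_unresolved[OF _ V a] dist_le_2[OF omit V(1)] by blast
  next
    case q
    note q' = q[unfolded insert_commute[of p q]]
    have "gateway q p v"
      using gateway_if_unresolved[OF _ V(2,1) V(3)[symmetric] b q'] dist_le_2[OF omit V(2)]
      by blast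
    then show ?thesis by blast
  qed
qed

text \<open>
  By the diameter bound, the neighbour \<open>v\<close> of the leaf \<open>p\<close> is adjacent to everything. A vertex \<open>q\<close> with
  another neighbour \<open>w\<close> could be omitted together with \<open>v\<close>: \<open>p\<close> tells \<open>v\<close> and \<open>q\<close> apart, \<open>v\<close> has the two
  neighbours \<open>p\<close> and \<open>w\<close> besides \<open>q\<close>, and \<open>w\<close>, not being adjacent to \<open>p\<close>, is no gateway for \<open>q\<close>.
\<close>

lemma core_if_leaf:
  assumes omit: no_pair_omittable and p: "p \<sim> v" "\<And>x. p \<sim> x \<Longrightarrow> x = v"
  shows "core {v}"
proof -
  have V: "p \<in> V" "v \<in> V" "p \<noteq> v" using wellformed'[OF p(1)] no_loops'[OF p(1)] by blast+
  have dom: "v \<sim> x" if x: "x \<in> V" "x \<noteq> v" for x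
  proof (cases "x = p")
    case True
    then show ?thesis using p(1) adj_sym by blast
  next
    case False
    then obtain y where "p \<sim> y" "d p x = Suc (d y x)" using dist_Suc_step V x by blast
    then have "d p x = Suc (d v x)" using p(2) by blast
    then have "d v x \<le> 1" using dist_le_2[OF omit V(1) x(1)] by simp
    then show ?thesis using adj_if_dist_le_1 V x by metis
  qed
  have "w = v" if q: "q \<in> V" "q \<noteq> v" "q \<sim> w" for q w
  proof (rule ccontr)
    assume "w \<noteq> v"
    have "q \<noteq> p" "w \<noteq> p" using q p(2) adj_sym \<open>w \<noteq> v\<close> by blast+
    have w: "w \<in> V" "w \<noteq> q" using wellformed'[OF q(3)] no_loops'[OF q(3)] by blast+
    have "twins v q \<or> (\<exists>u. gateway v q u) \<or> (\<exists>u. gateway q v u)"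
      by (rule twins_or_gateway[OF omit V(2) q(1) _ _ _ q(3)])
        (use q \<open>w \<noteq> v\<close> \<open>q \<noteq> p\<close> adj_sym p(1) in auto)
    then consider "twins v q" | u where "gateway v q u" | u where "gateway q v u" by blast
    then show False
    proof cases
      case 1
      then have "q \<sim> p" using V \<open>q \<noteq> p\<close> p(1) adj_sym unfolding twins_def by blast
      then show False using p(2) adj_sym q(2) by blast
    next
      case 2
      moreover have "v \<sim> p" "v \<sim> w" using dom V w \<open>w \<noteq> v\<close> by auto
      ultimately show False using \<open>q \<noteq> p\<close> w(2) \<open>w \<noteq> p\<close> unfolding gateway_def by blast
    next
      case 3
      then have "w = u" using q(3) \<open>w \<noteq> v\<close> unfolding gateway_def by blast
      then have "w \<sim> p" using 3 V \<open>w \<noteq> p\<close> unfolding gateway_def by blast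
      then show False using p(2) adj_sym \<open>w \<noteq> v\<close> by blast
    qed
  qed
  then have "r \<sim> w \<longleftrightarrow> w \<in> {v}" if "r \<in> V - {v}" for r w
    using that adj_sym[OF dom[of r]] by auto
  then show ?thesis unfolding core_def using V(2) by simp
qed

text \<open>
  Without leaves, any vertex with all neighbours among \<open>v\<close> and \<open>q\<close> is adjacent to both; in particular
  \<open>p\<close> is. For a further vertex \<open>r\<close>, consider the pair \<open>r\<close>, \<open>q\<close>.
\<close>

lemma core_if_gateway:
  assumes omit: no_pair_omittable
    and no_leaf: "\<And>u y. u \<in> V \<Longrightarrow> \<exists>x. x \<noteq> y \<and> u \<sim> x"
    and V: "p \<in> V" "q \<in> V" "p \<noteq> q" and gw: "gateway p q v"
  shows "core {v, q}"
proof -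
  have v: "v \<in> V" "v \<noteq> p" "v \<noteq> q" "\<And>x. p \<sim> x \<Longrightarrow> x = v \<or> x = q"
    "\<And>x. x \<in> V - {v, q} \<Longrightarrow> v \<sim> x"
    using gw unfolding gateway_def by auto
  have both: "u \<sim> v \<and> u \<sim> q" if "u \<in> V" "\<And>x. u \<sim> x \<Longrightarrow> x = v \<or> x = q" for u
    using that no_leaf by metis
  then have "p \<sim> q" using v(4) V(1) by blast
  have nbhd: "x = v \<or> x = q" if r: "r \<in> V - {v, q}" "r \<sim> x" for r x
  proof (cases "r = p")
    case True
    then show ?thesis using r v(4) by blast
  next
    case False
    then have "\<not> r \<sim> p" using r v(4) adj_sym by blast
    have "r \<sim> v" using r v(5) adj_sym by blast
    obtain a where a: "r \<sim> a" "a \<noteq> q" using no_leaf r by blast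
    obtain b where b: "q \<sim> b" "b \<noteq> r" using no_leaf V by blast
    from twins_or_gateway[OF omit _ V(2) _ a b] r
    consider "twins r q" | u where "gateway r q u" | u where "gateway q r u" by blast
    then show ?thesis
    proof cases
      \<comment> \<open>Twins are ruled out by \<open>p\<close>, which is adjacent to \<open>q\<close> but not to \<open>r\<close>.\<close>
      case 1
      then have "r \<sim> p" using \<open>p \<sim> q\<close> adj_sym V False unfolding twins_def by blast
      then show ?thesis using \<open>\<not> r \<sim> p\<close> by blast
    next
      \<comment> \<open>Since \<open>r\<close> is adjacent to \<open>v\<close>, its gateway is \<open>v\<close>.\<close>
      case 2
      then have "v = u" using \<open>r \<sim> v\<close> v(3) unfolding gateway_def by blast
      then show ?thesis using 2 r unfolding gateway_def by blast
    next
      \<comment> \<open>The gateway of \<open>q\<close> is its neighbour \<open>p\<close>. So \<open>p\<close> is adjacent to all vertices but \<open>r\<close>, and only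
        \<open>p\<close>, \<open>v\<close>, \<open>q\<close>, \<open>r\<close> exist.\<close>
      case 3
      then have "u = p" using \<open>p \<sim> q\<close> adj_sym False unfolding gateway_def by blast
      moreover have "x \<in> V" "x \<noteq> r" "x \<noteq> p"
        using r wellformed'[OF r(2)] no_loops'[OF r(2)] \<open>\<not> r \<sim> p\<close> by blast+
      ultimately have "p \<sim> x" using 3 unfolding gateway_def by blast
      then show ?thesis using v(4) by blast
    qed
  qed
  then have "r \<sim> x \<longleftrightarrow> x \<in> {v, q}" if "r \<in> V - {v, q}" for r x
    using that both[of r] by auto
  then show ?thesis unfolding core_def using v(1) V(2) by simp
qed

theorem no_pair_omittable_iff:
  assumes "3 \<le> card V"
  shows "no_pair_omittable \<longleftrightarrow> complete \<or> (\<exists>A. core A \<and> (card A = 1 \<or> card A = 2))"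
proof
  assume omit: no_pair_omittable
  show "complete \<or> (\<exists>A. core A \<and> (card A = 1 \<or> card A = 2))"
  proof (cases "\<forall>u\<in>V. \<forall>y. \<exists>x. x \<noteq> y \<and> u \<sim> x")
    case False
    then obtain p v where p: "p \<in> V" "\<And>x. p \<sim> x \<Longrightarrow> x = v" by blast
    have "V \<noteq> {p}" using assms by auto
    then obtain w where "w \<in> V" "p \<noteq> w" using p(1) by auto
    then obtain x where "p \<sim> x" using dist_Suc_step p(1) by metis
    then have "core {v}" using core_if_leaf[OF omit, of p v] p(2) by metis
    moreover have "card {v} = 1" by simp
    ultimately show ?thesis by blast
  next
    case True
    then have no_leaf: "\<exists>x. x \<noteq> y \<and> u \<sim> x" if "u \<in> V" for u y using that by blast
    show ?thesis
    proof (cases "\<exists>p\<in>V. \<exists>q\<in>V. p \<noteq> q \<and> \<not> twins p q")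
      case True
      then obtain p q where pq: "p \<in> V" "q \<in> V" "p \<noteq> q" "\<not> twins p q" by blast
      obtain a b where "p \<sim> a" "a \<noteq> q" "q \<sim> b" "b \<noteq> p"
        using no_leaf[OF pq(1), of q] no_leaf[OF pq(2), of p] by blast
      then consider v where "gateway p q v" | v where "gateway q p v"
        using twins_or_gateway[OF omit pq(1-3)] pq(4) by blast
      then obtain v w where "core {v, w}" "v \<noteq> w"
      proof cases
        case (1 v)
        have "core {v, q}" by (rule core_if_gateway[OF omit no_leaf pq(1-3) 1])
        then show thesis using that[of v q] 1 unfolding gateway_def by blast
      next
        case (2 v)
        have "core {v, p}"
          by (rule core_if_gateway[OF omit no_leaf pq(2,1) pq(3)[symmetric] 2])
        then show thesis using that[of v p] 2 unfolding gateway_def by blast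
      qed
      moreover have "card {v, w} = 2" using \<open>v \<noteq> w\<close> by simp
      ultimately show ?thesis by blast
    next
      case False
      have "u \<sim> w" if uw: "u \<in> V" "w \<in> V" "u \<noteq> w" for u w
      proof -
        obtain x where x: "u \<sim> x" "x \<noteq> w" using no_leaf[OF uw(1), of w] by blast
        then have "x \<in> V" "x \<noteq> u" using wellformed'[OF x(1)] no_loops'[OF x(1)] by blast+
        then have "twins x w" using False uw(2) x(2) by blast
        then have "w \<sim> u" using adj_sym[OF x(1)] uw \<open>x \<noteq> u\<close> unfolding twins_def by blast
        then show ?thesis by (rule adj_sym)
      qed
      then show ?thesis unfolding complete_def by blast
    qed
  qed
qed (use no_pair_omittable_complete no_pair_omittable_core in blast)

end

section \<open>Recognising the four families\<close>

text \<open>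
  An isomorphism in the sense of \<^const>\<open>digraph_iso\<close> also maps arcs and carries new tail and head
  functions. For arcs that are pairs of vertices, the vertex map determines all of these.
\<close>

lemma digraph_iso_pair_iff:
  assumes "pair_wf_digraph G" "pair_wf_digraph H"
  shows "digraph_iso (with_proj G) (with_proj H) \<longleftrightarrow>
    (\<exists>f. bij_betw f (pverts G) (pverts H) \<and>
      (\<forall>u\<in>pverts G. \<forall>v\<in>pverts G. (u, v) \<in> parcs G \<longleftrightarrow> (f u, f v) \<in> parcs H))"
    (is "_ \<longleftrightarrow> (\<exists>f. ?iso f)")
proof
  interpret G: pair_wf_digraph G by fact
  assume "digraph_iso (with_proj G) (with_proj H)"
  then obtain h where h: "pre_digraph.digraph_isomorphism (with_proj G) h"
    and H: "with_proj H = app_iso h (with_proj G)"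
    unfolding digraph_iso_def by blast
  let ?f = "iso_verts h"
  have inj: "inj_on ?f (pverts G)"
    using h by (simp add: pre_digraph.digraph_isomorphism_def)
  have verts: "pverts H = ?f ` pverts G"
    using arg_cong[OF H, of verts] by simp
  have "arcs_ends (with_proj H) = (\<lambda>(u, v). (?f u, ?f v)) ` arcs_ends (with_proj G)"
    unfolding H by (rule wf_digraph.arcs_ends_app_iso_eq[OF G.wf_digraph_axioms h])
  then have arcs: "parcs H = (\<lambda>(u, v). (?f u, ?f v)) ` parcs G" by simp
  have "(u, v) \<in> parcs G" if uv: "u \<in> pverts G" "v \<in> pverts G" "(?f u, ?f v) \<in> parcs H" for u v
  proof -
    obtain u' v' where uv': "(u', v') \<in> parcs G" "?f u = ?f u'" "?f v = ?f v'"
      using uv(3) unfolding arcs by auto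
    then show ?thesis
      using inj_onD[OF inj uv'(2)] inj_onD[OF inj uv'(3)] uv G.wellformed'[OF uv'(1)] by simp
  qed
  moreover have "(?f u, ?f v) \<in> parcs H" if "(u, v) \<in> parcs G" for u v
    using that unfolding arcs by force
  moreover have "bij_betw ?f (pverts G) (pverts H)"
    using inj verts by (simp add: bij_betw_def)
  ultimately have "?iso ?f" by blast
  then show "\<exists>f. ?iso f" by (rule exI[of ?iso ?f])
next
  interpret G: pair_wf_digraph G by fact
  interpret H: pair_wf_digraph H by fact
  assume "\<exists>f. ?iso f"
  then obtain f where f: "?iso f" ..
  then have inj: "inj_on f (pverts G)" and verts: "pverts H = f ` pverts G"
    by (auto simp: bij_betw_def)
  define h where "h = \<lparr>iso_verts = f, iso_arcs = map_prod f f, iso_head = snd, iso_tail = fst\<rparr>"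
  have "inj_on (map_prod f f) (parcs G)"
    by (rule inj_on_subset[OF map_prod_inj_on[OF inj inj]]) (auto dest: G.wellformed')
  then have iso: "pre_digraph.digraph_isomorphism (with_proj G) h"
    using inj G.wf_digraph_axioms
    by (auto simp: pre_digraph.digraph_isomorphism_def h_def)
  have "parcs H = map_prod f f ` parcs G"
  proof (intro equalityI subsetI)
    fix e assume e: "e \<in> parcs H"
    then have "fst e \<in> f ` pverts G" "snd e \<in> f ` pverts G"
      using H.arc_fst_in_verts H.arc_snd_in_verts verts by auto
    then obtain u v where uv: "u \<in> pverts G" "v \<in> pverts G" "e = (f u, f v)"
      by (cases e) auto
    then have "(u, v) \<in> parcs G" using f e by blast
    then show "e \<in> map_prod f f ` parcs G" using uv(3) by force
  next
    fix e assume "e \<in> map_prod f f ` parcs G"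
    then obtain u v where "(u, v) \<in> parcs G" "e = (f u, f v)" by auto
    then show "e \<in> parcs H" using f G.wellformed' by blast
  qed
  then have "with_proj H = app_iso h (with_proj G)"
    using verts by (simp add: app_iso_def h_def with_proj_def)
  then show "digraph_iso (with_proj G) (with_proj H)"
    using iso unfolding digraph_iso_def by blast
qed

abbreviation (input) K2_join_independent :: "nat \<Rightarrow> (nat + nat) pair_pre_digraph" where
  "K2_join_independent m \<equiv> complete_graph 2 \<or>\<^sub>G graph_complement (complete_graph m)"

lemma pverts_K2_join_independent: "pverts (K2_join_independent m) = {..<2} <+> {..<m}"
  by (simp add: graph_join_def graph_complement_def complete_graph_def)

lemma parcs_K2_join_independent:
  "(x, y) \<in> parcs (K2_join_independent m) \<longleftrightarrow>
    x \<in> {..<2} <+> {..<m} \<and> y \<in> {..<2} <+> {..<m} \<and> x \<noteq> y \<and> (x \<in> range Inl \<or> y \<in> range Inl)"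
  unfolding graph_join_def pair_pre_digraph.select_convs parcs_complement_complete_graph
  by (auto simp: complete_graph_def graph_complement_def image_iff)

lemma pair_wf_K2_join_independent: "pair_wf_digraph (K2_join_independent m)"
  by unfold_locales
    (auto simp: pverts_K2_join_independent parcs_K2_join_independent simp del: Plus_def)

context connected_pair_graph
begin

lemma complete_iff: "K\<^bsub>card V\<^esub> (with_proj G) \<longleftrightarrow> complete"
proof -
  have "parcs G \<subseteq> {(u, v). (u, v) \<in> V \<times> V \<and> u \<noteq> v}"
    by (auto dest: wellformed' no_loops')
  then show ?thesis
    unfolding complete_digraph_pair_def complete_def using pair_finite_verts by auto
qed

lemma core_adj_iff:
  assumes "core A" "u \<in> V" "v \<in> V" "\<not> (u \<in> A \<and> v \<in> A)"
  shows "u \<sim> v \<longleftrightarrow> u \<in> A \<or> v \<in> A"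
proof (cases "u \<in> A")
  case True
  then have "v \<sim> u" using assms unfolding core_def by blast
  then show ?thesis using True adj_sym by blast
next
  case False
  then show ?thesis using assms unfolding core_def by blast
qed

lemma complete_bipartite_iff:
  "K\<^bsub>m, card V - m\<^esub> (with_proj G) \<longleftrightarrow>
    (\<exists>A. core A \<and> card A = m \<and> (\<forall>u\<in>A. \<forall>v\<in>A. \<not> u \<sim> v))" (is "?K \<longleftrightarrow> ?C")
proof
  assume ?K
  then obtain A B where "V = A \<union> B" "A \<inter> B = {}" "card A = m" "parcs G = A \<times> B \<union> B \<times> A"
    unfolding complete_bipartite_digraph_pair_def by blast
  then have "core A \<and> card A = m \<and> (\<forall>u\<in>A. \<forall>v\<in>A. \<not> u \<sim> v)"
    unfolding core_def by auto
  then show ?C ..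
next
  assume ?C
  then obtain A where A: "core A" "card A = m" "\<forall>u\<in>A. \<forall>v\<in>A. \<not> u \<sim> v" by blast
  have sub: "A \<subseteq> V" using A(1) unfolding core_def by blast
  have "e \<in> parcs G \<longleftrightarrow> e \<in> A \<times> (V - A) \<union> (V - A) \<times> A" for e
  proof (cases e)
    case (Pair u v)
    show ?thesis
    proof (cases "u \<in> V \<and> v \<in> V")
      case True
      then show ?thesis
        using core_adj_iff[OF A(1), of u v] A(3) Pair by auto
    next
      case False
      then show ?thesis using wellformed'[of u v] sub Pair by auto
    qed
  qed
  then have "parcs G = A \<times> (V - A) \<union> (V - A) \<times> A" by blast
  moreover have "card (V - A) = card V - m"
    using A(2) sub pair_finite_verts by (simp add: card_Diff_subset finite_subset)
  moreover have "V = A \<union> (V - A)" "A \<inter> (V - A) = {}" using sub by auto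
  ultimately show ?K
    unfolding complete_bipartite_digraph_pair_def using A(2) pair_finite_verts by metis
qed

lemma iso_K2_join_independent_iff:
  "digraph_iso (with_proj G) (with_proj (K2_join_independent (card V - 2))) \<longleftrightarrow>
    (\<exists>A. core A \<and> card A = 2 \<and> (\<forall>u\<in>A. \<forall>v\<in>A. u \<noteq> v \<longrightarrow> u \<sim> v))" (is "?I \<longleftrightarrow> ?C")
proof -
  let ?H = "K2_join_independent (card V - 2)"
  note iso = digraph_iso_pair_iff[OF pair_wf_digraph pair_wf_K2_join_independent]
  show ?thesis
  proof
    assume ?I
    then obtain f where f: "bij_betw f V ({..<2} <+> {..<card V - 2})"
      and arcs: "\<And>u v. u \<in> V \<Longrightarrow> v \<in> V \<Longrightarrow> u \<sim> v \<longleftrightarrow> (f u, f v) \<in> parcs ?H"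
      unfolding iso pverts_K2_join_independent by blast
    \<comment> \<open>The vertices that correspond to the two vertices of \<open>K\<^sub>2\<close>.\<close>
    define A where "A = {v \<in> V. f v \<in> range Inl}"
    have fV: "f v \<in> {..<2} <+> {..<card V - 2}" if "v \<in> V" for v
      using f that by (auto simp: bij_betw_def)
    have adj: "u \<sim> v \<longleftrightarrow> u \<noteq> v \<and> (u \<in> A \<or> v \<in> A)" if "u \<in> V" "v \<in> V" for u v
      unfolding arcs[OF that] parcs_K2_join_independent A_def
      using fV[OF that(1)] fV[OF that(2)] inj_on_eq_iff[OF bij_betw_imp_inj_on[OF f] that] that
      by blast
    have "f ` A = Inl ` {..<2}"
    proof (intro equalityI subsetI)
      fix y assume "y \<in> f ` A"
      then obtain v where "v \<in> V" "f v \<in> range Inl" "y = f v" unfolding A_def by blast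
      then show "y \<in> Inl ` {..<2}" using fV[of v] by auto
    next
      fix y :: "nat + nat" assume y: "y \<in> Inl ` {..<2}"
      then obtain v where "v \<in> V" "y = f v" using f unfolding bij_betw_def by blast
      then show "y \<in> f ` A" using y unfolding A_def by blast
    qed
    moreover have "inj_on f A"
      using f unfolding A_def bij_betw_def by (auto intro: inj_on_subset)
    ultimately have "card A = card (Inl ` {..<2::nat} :: (nat + nat) set)"
      using card_image by metis
    then have "card A = 2" by (simp add: card_image)
    moreover have "A \<subseteq> V" unfolding A_def by blast
    moreover have "r \<sim> v \<longleftrightarrow> v \<in> A" if "r \<in> V - A" for r v
      using adj[of r v] that wellformed'[of r v] \<open>A \<subseteq> V\<close> by auto
    ultimately have "core A \<and> card A = 2 \<and> (\<forall>u\<in>A. \<forall>v\<in>A. u \<noteq> v \<longrightarrow> u \<sim> v)"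
      unfolding core_def using adj by blast
    then show ?C ..
  next
    assume ?C
    then obtain A where A: "core A" "card A = 2" "\<And>u v. u \<in> A \<Longrightarrow> v \<in> A \<Longrightarrow> u \<noteq> v \<Longrightarrow> u \<sim> v"
      by blast
    have sub: "A \<subseteq> V" using A(1) unfolding core_def by blast
    then have fin: "finite A" "finite (V - A)" using pair_finite_verts by (auto intro: finite_subset)
    have "card (V - A) = card V - 2"
      using A(2) sub fin by (simp add: card_Diff_subset)
    then obtain g h where g: "bij_betw g A {..<2::nat}" and h: "bij_betw h (V - A) {..<card V - 2}"
      using A(2) fin finite_same_card_bij by (metis card_lessThan finite_lessThan)
    define f where "f v = (if v \<in> A then Inl (g v) else Inr (h v))" for v
    have fA: "f ` A = Inl ` {..<2}"
      using g by (auto simp: f_def bij_betw_def image_iff)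
    have fB: "f ` (V - A) = Inr ` {..<card V - 2}"
      using h by (auto simp: f_def bij_betw_def image_iff)
    have "f ` V = f ` A \<union> f ` (V - A)" using sub by blast
    then have img: "f ` V = {..<2} <+> {..<card V - 2}" unfolding fA fB Plus_def .
    have inj: "inj_on f V"
      using g h by (auto simp: inj_on_def f_def bij_betw_def)
    have "u \<sim> v \<longleftrightarrow> (f u, f v) \<in> parcs ?H" if uv: "u \<in> V" "v \<in> V" for u v
    proof -
      have "(f u, f v) \<in> parcs ?H \<longleftrightarrow> u \<noteq> v \<and> (u \<in> A \<or> v \<in> A)"
        unfolding parcs_K2_join_independent img[symmetric]
        using uv inj_on_eq_iff[OF inj uv] by (auto simp: f_def)
      moreover have "u \<sim> v \<longleftrightarrow> u \<noteq> v \<and> (u \<in> A \<or> v \<in> A)"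
        using A(3)[of u v] core_adj_iff[OF A(1) uv] no_loops'[of u v] by blast
      ultimately show ?thesis by simp
    qed
    then show ?I
      unfolding iso pverts_K2_join_independent using inj img by (auto simp: bij_betw_def)
  qed
qed

text \<open>
  A core of one vertex is independent; a core of two vertices is independent or a clique.
\<close>

lemma core_1_or_2_iff:
  "(\<exists>A. core A \<and> (card A = 1 \<or> card A = 2)) \<longleftrightarrow>
    K\<^bsub>1, card V - 1\<^esub> (with_proj G) \<or> K\<^bsub>2, card V - 2\<^esub> (with_proj G) \<or>
    digraph_iso (with_proj G) (with_proj (K2_join_independent (card V - 2)))"
proof -
  define indep clique where "indep A \<longleftrightarrow> (\<forall>u\<in>A. \<forall>v\<in>A. \<not> u \<sim> v)"
    and "clique A \<longleftrightarrow> (\<forall>u\<in>A. \<forall>v\<in>A. u \<noteq> v \<longrightarrow> u \<sim> v)" for A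
  have one: "indep A" if "card A = 1" for A
    using that no_loops' unfolding indep_def by (auto simp: card_1_singleton_iff)
  have two: "indep A \<or> clique A" if "card A = 2" for A
    using that no_loops' adj_sym unfolding indep_def clique_def by (auto simp: card_2_iff)
  show ?thesis
    unfolding complete_bipartite_iff iso_K2_join_independent_iff indep_def[symmetric] clique_def[symmetric]
    using one two by metis
qed

end

theorem theorem3p3:
  fixes G :: "'a pair_pre_digraph" and n :: nat
  assumes "pair_graph G"
    and "Digraph_Component.connected (with_proj G)"
    and "card (pverts G) = n"
    and "n \<ge> 3"
  shows "doubly_resolving_number (with_proj G) = n - 1 \<longleftrightarrow>
    K\<^bsub>n\<^esub> (with_proj G) \<or>
    K\<^bsub>1, n - 1\<^esub> (with_proj G) \<or>
    K\<^bsub>2, n - 2\<^esub> (with_proj G) \<or>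
    digraph_iso (with_proj G)
      (with_proj (complete_graph 2 \<or>\<^sub>G graph_complement (complete_graph (n - 2))))"
proof -
  interpret connected_pair_graph G
    using assms(1,2) by (simp add: connected_pair_graph_def connected_pair_graph_axioms_def)
  have n: "3 \<le> card V" using assms(3,4) by simp
  show ?thesis
    unfolding assms(3)[symmetric] doubly_resolving_number_eq_iff[OF n]
      no_pair_omittable_iff[OF n] complete_iff core_1_or_2_iff by blast
qed

end
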